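(* Let $A$ be an atomic domain and let $S\subseteq A$ be a saturated multiplicative set such that every nonunit element of $S$ is a product of good atoms of $A$. If the fraction ring $A_S$ is a half-factorial domain (HFD), then $A$ is an HFD.
   Context: Domain means (commutative) integral domain. An atom (irreducible element) of a domain $A$ is a nonzero nonunit that is not a product of two nonunits of $A$. $A$ is atomic if every nonzero nonunit of $A$ is a product of finitely many atoms. $A$ is a half-factorial domain (HFD) if $A$ is atomic and, for each nonzero nonunit $x\in A$, all factorizations of $x$ into atoms have the same length (number of factors). A multiplicative set $S$ (closed under multiplication, containing $1$) is saturated if every divisor in $A$ of an element of $S$ lies in $S$. $A_S$ denotes the localization of $A$ at $S$. Let $A$ be an atomic domain. An atomic equality is an equality $a_1\cdots a_n=b_1\cdots b_m$ in which all factors $a_i,b_j$ are atoms of $A$ ($n,m\ge 1$). It is balanced if $n=m$ and unbalanced if $n\ne m$. It is irredundant if no proper subproduct of the $a$'s is associated to a proper subproduct of the $b$'s, i.e. $\prod_{i\in I}a_i$ is not associated (equal up to a unit factor of $A$) to $\prod_{j\in J}b_j$ for all nonempty proper subsets $I\subsetneq\{1,\dots,n\}$, $J\subsetneq\{1,\dots,m\}$. A bad atom is an atom that appears (as one of the $a_i$ or $b_j$) in some irredundant unbalanced atomic equality. A good atom is an atom that is not bad. *)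

theory Defs
  imports "HOL-Algebra.Ring_Divisibility"
begin

section \<open>Atoms and half-factorial domains\<close>

text \<open>The predicate \<open>ring_irreducible\<close> does not include membership in the carrier.\<close>

definition atom :: "('a, 'b) ring_scheme \<Rightarrow> 'a \<Rightarrow> bool"
  where "atom R a \<longleftrightarrow> a \<in> carrier R \<and> ring_irreducible\<^bsub>R\<^esub> a"

lemma (in domain) atom_iff:
  "atom R a \<longleftrightarrow> a \<in> carrier R \<and> a \<noteq> \<zero> \<and> a \<notin> Units R \<and>
    \<not> (\<exists>b\<in>carrier R - Units R. \<exists>c\<in>carrier R - Units R. a = b \<otimes> c)"
proof
  assume "atom R a"
  then have a: "a \<in> carrier R" "ring_irreducible a"
    by (auto simp: atom_def)
  show "a \<in> carrier R \<and> a \<noteq> \<zero> \<and> a \<notin> Units R \<and>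
    \<not> (\<exists>b\<in>carrier R - Units R. \<exists>c\<in>carrier R - Units R. a = b \<otimes> c)"
    using a(1) ring_irreducibleE(1,4,5)[OF a] by blast
next
  assume "a \<in> carrier R \<and> a \<noteq> \<zero> \<and> a \<notin> Units R \<and>
    \<not> (\<exists>b\<in>carrier R - Units R. \<exists>c\<in>carrier R - Units R. a = b \<otimes> c)"
  then show "atom R a"
    unfolding atom_def by (intro conjI ring_irreducibleI) auto
qed

definition atomic_factorization :: "('a, 'b) ring_scheme \<Rightarrow> nat \<Rightarrow> (nat \<Rightarrow> 'a) \<Rightarrow> 'a \<Rightarrow> bool"
  where "atomic_factorization R n p x \<longleftrightarrow>
    (\<forall>i\<in>{1..n}. atom R (p i)) \<and> x = (\<Otimes>\<^bsub>R\<^esub>i\<in>{1..n}. p i)"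

locale atomic_domain = domain +
  assumes atomic: "\<lbrakk>x \<in> carrier R; x \<noteq> \<zero>; x \<notin> Units R\<rbrakk> \<Longrightarrow> \<exists>n p. atomic_factorization R n p x"

locale half_factorial_domain = atomic_domain +
  assumes half_factorial:
    "\<lbrakk>x \<in> carrier R; x \<noteq> \<zero>; x \<notin> Units R;
      atomic_factorization R n p x; atomic_factorization R m q x\<rbrakk> \<Longrightarrow> n = m"


section \<open>Good and bad atoms\<close>

definition atomic_equality ::
    "('a, 'b) ring_scheme \<Rightarrow> nat \<Rightarrow> (nat \<Rightarrow> 'a) \<Rightarrow> nat \<Rightarrow> (nat \<Rightarrow> 'a) \<Rightarrow> bool"
  where "atomic_equality R n a m b \<longleftrightarrow> n \<ge> 1 \<and> m \<ge> 1 \<and>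
    (\<forall>i\<in>{1..n}. atom R (a i)) \<and> (\<forall>j\<in>{1..m}. atom R (b j)) \<and>
    (\<Otimes>\<^bsub>R\<^esub>i\<in>{1..n}. a i) = (\<Otimes>\<^bsub>R\<^esub>j\<in>{1..m}. b j)"

text \<open>
  In a domain, \<open>x \<sim>\<^bsub>R\<^esub> y\<close> means that \<open>x\<close> and \<open>y\<close> are equal up to a unit factor,
  by \<open>domain.ring_associated_iff\<close>.
\<close>

definition irredundant ::
    "('a, 'b) ring_scheme \<Rightarrow> nat \<Rightarrow> (nat \<Rightarrow> 'a) \<Rightarrow> nat \<Rightarrow> (nat \<Rightarrow> 'a) \<Rightarrow> bool"
  where "irredundant R n a m b \<longleftrightarrow>
    (\<forall>I J. I \<noteq> {} \<and> I \<subset> {1..n} \<and> J \<noteq> {} \<and> J \<subset> {1..m} \<longrightarrow>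
      \<not> (\<Otimes>\<^bsub>R\<^esub>i\<in>I. a i) \<sim>\<^bsub>R\<^esub> (\<Otimes>\<^bsub>R\<^esub>j\<in>J. b j))"

definition bad_atom :: "('a, 'b) ring_scheme \<Rightarrow> 'a \<Rightarrow> bool"
  where "bad_atom R p \<longleftrightarrow>
    (\<exists>n a m b. atomic_equality R n a m b \<and> n \<noteq> m \<and> irredundant R n a m b \<and>
      p \<in> a ` {1..n} \<union> b ` {1..m})"

definition good_atom :: "('a, 'b) ring_scheme \<Rightarrow> 'a \<Rightarrow> bool"
  where "good_atom R p \<longleftrightarrow> atom R p \<and> \<not> bad_atom R p"


section \<open>Localization\<close>

definition saturated_mult_set :: "('a, 'b) ring_scheme \<Rightarrow> 'a set \<Rightarrow> bool"
  where "saturated_mult_set R S \<longleftrightarrow> submonoid S R \<and>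
    (\<forall>s\<in>S. \<forall>d\<in>carrier R. d divides\<^bsub>R\<^esub> s \<longrightarrow> d \<in> S)"

text \<open>
  The pair \<open>(a, s)\<close> represents the fraction \<open>a / s\<close>. The extra factor \<open>u\<close> makes the relation an
  equivalence over every commutative ring; over a domain with \<open>\<zero> \<notin> S\<close> it can be cancelled.
\<close>

definition frac_rel :: "('a, 'b) ring_scheme \<Rightarrow> 'a set \<Rightarrow> (('a \<times> 'a) \<times> ('a \<times> 'a)) set"
  where "frac_rel R S = {((a, s), (b, t)). a \<in> carrier R \<and> s \<in> S \<and> b \<in> carrier R \<and> t \<in> S \<and>
    (\<exists>u\<in>S. u \<otimes>\<^bsub>R\<^esub> (a \<otimes>\<^bsub>R\<^esub> t) = u \<otimes>\<^bsub>R\<^esub> (b \<otimes>\<^bsub>R\<^esub> s))}"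

definition fraction :: "('a, 'b) ring_scheme \<Rightarrow> 'a set \<Rightarrow> 'a \<Rightarrow> 'a \<Rightarrow> ('a \<times> 'a) set"
  where "fraction R S a s = frac_rel R S `` {(a, s)}"

text \<open>
  The unions run over all representatives of the two classes; lemmas \<open>mult_fraction\<close> and \<open>add_fraction\<close>
  below show that the result does not depend on them.
\<close>

definition localization :: "('a, 'b) ring_scheme \<Rightarrow> 'a set \<Rightarrow> ('a \<times> 'a) set ring"
  where "localization R S =
    \<lparr>carrier = (carrier R \<times> S) // frac_rel R S,
     mult = (\<lambda>P Q. \<Union>(a, s)\<in>P. \<Union>(b, t)\<in>Q. fraction R S (a \<otimes>\<^bsub>R\<^esub> b) (s \<otimes>\<^bsub>R\<^esub> t)),
     one = fraction R S \<one>\<^bsub>R\<^esub> \<one>\<^bsub>R\<^esub>,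
     zero = fraction R S \<zero>\<^bsub>R\<^esub> \<one>\<^bsub>R\<^esub>,
     add = (\<lambda>P Q. \<Union>(a, s)\<in>P. \<Union>(b, t)\<in>Q.
       fraction R S (a \<otimes>\<^bsub>R\<^esub> t \<oplus>\<^bsub>R\<^esub> b \<otimes>\<^bsub>R\<^esub> s) (s \<otimes>\<^bsub>R\<^esub> t))\<rparr>"

context cring
begin

context
  fixes S assumes S: "submonoid S R"
begin

lemma mult_set_carrier: "s \<in> S \<Longrightarrow> s \<in> carrier R"
  using submonoid.subset[OF S] by blast

lemma mult_set_one: "\<one> \<in> S"
  using submonoid.one_closed[OF S] .

lemma mult_set_mult: "\<lbrakk>s \<in> S; t \<in> S\<rbrakk> \<Longrightarrow> s \<otimes> t \<in> S"
  using submonoid.m_closed[OF S] .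

lemmas mult_set_simps = mult_set_carrier mult_set_one mult_set_mult

lemma frac_relI:
  "\<lbrakk>a \<in> carrier R; s \<in> S; b \<in> carrier R; t \<in> S; u \<in> S; u \<otimes> (a \<otimes> t) = u \<otimes> (b \<otimes> s)\<rbrakk>
    \<Longrightarrow> ((a, s), (b, t)) \<in> frac_rel R S"
  unfolding frac_rel_def by auto

lemma equiv_frac_rel: "equiv (carrier R \<times> S) (frac_rel R S)"
proof (rule equivI)
  show "frac_rel R S \<subseteq> (carrier R \<times> S) \<times> (carrier R \<times> S)"
    by (auto simp: frac_rel_def)
  show "refl_on (carrier R \<times> S) (frac_rel R S)"
    by (auto simp: refl_on_def intro!: frac_relI mult_set_one)
  show "sym (frac_rel R S)"
    by (clarsimp simp: sym_def frac_rel_def) metis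
  show "trans (frac_rel R S)"
  proof (rule transI, clarify)
    fix a s b t c v
    assume "((a, s), (b, t)) \<in> frac_rel R S" "((b, t), (c, v)) \<in> frac_rel R S"
    then obtain u w where
      m: "a \<in> carrier R" "b \<in> carrier R" "c \<in> carrier R" "s \<in> S" "t \<in> S" "v \<in> S" "u \<in> S" "w \<in> S"
      and u: "u \<otimes> (a \<otimes> t) = u \<otimes> (b \<otimes> s)" and w: "w \<otimes> (b \<otimes> v) = w \<otimes> (c \<otimes> t)"
      by (auto simp: frac_rel_def)
    note [simp] = m mult_set_carrier
    have "(u \<otimes> w \<otimes> t) \<otimes> (a \<otimes> v) = (u \<otimes> (a \<otimes> t)) \<otimes> (w \<otimes> v)"
      by (simp add: m_ac)
    also have "\<dots> = (w \<otimes> (b \<otimes> v)) \<otimes> (u \<otimes> s)"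
      unfolding u by (simp add: m_ac)
    also have "\<dots> = (u \<otimes> w \<otimes> t) \<otimes> (c \<otimes> s)"
      unfolding w by (simp add: m_ac)
    finally show "((a, s), (c, v)) \<in> frac_rel R S"
      using m by (intro frac_relI[of _ _ _ _ "u \<otimes> w \<otimes> t"]) (auto simp: mult_set_mult)
  qed
qed

lemma fraction_eq_iff:
  assumes "a \<in> carrier R" "s \<in> S" "b \<in> carrier R" "t \<in> S"
  shows "fraction R S a s = fraction R S b t \<longleftrightarrow> (\<exists>u\<in>S. u \<otimes> (a \<otimes> t) = u \<otimes> (b \<otimes> s))"
  using eq_equiv_class_iff[OF equiv_frac_rel, of "(a, s)" "(b, t)"] assms
  by (simp add: fraction_def frac_rel_def)

lemma fraction_eqI:
  assumes "a \<in> carrier R" "s \<in> S" "b \<in> carrier R" "t \<in> S" "a \<otimes> t = b \<otimes> s"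
  shows "fraction R S a s = fraction R S b t"
  using assms fraction_eq_iff mult_set_one by metis

lemma carrier_localization:
  "carrier (localization R S) = {fraction R S a s | a s. a \<in> carrier R \<and> s \<in> S}"
  by (auto simp: localization_def quotient_def fraction_def)

lemma fraction_carrier: "\<lbrakk>a \<in> carrier R; s \<in> S\<rbrakk> \<Longrightarrow> fraction R S a s \<in> carrier (localization R S)"
  by (auto simp: carrier_localization)

lemma mult_fraction:
  assumes "a \<in> carrier R" "s \<in> S" "b \<in> carrier R" "t \<in> S"
  shows "fraction R S a s \<otimes>\<^bsub>localization R S\<^esub> fraction R S b t = fraction R S (a \<otimes> b) (s \<otimes> t)"
proof -
  have "congruent2 (frac_rel R S) (frac_rel R S)
      (\<lambda>x y. fraction R S (fst x \<otimes> fst y) (snd x \<otimes> snd y))"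
  proof (rule congruent2I', clarsimp)
    fix a s a' s' b t b' t'
    assume "((a, s), (a', s')) \<in> frac_rel R S" "((b, t), (b', t')) \<in> frac_rel R S"
    then obtain u w where
      m: "a \<in> carrier R" "a' \<in> carrier R" "b \<in> carrier R" "b' \<in> carrier R"
        "s \<in> S" "s' \<in> S" "t \<in> S" "t' \<in> S" "u \<in> S" "w \<in> S"
      and u: "u \<otimes> (a \<otimes> s') = u \<otimes> (a' \<otimes> s)" and w: "w \<otimes> (b \<otimes> t') = w \<otimes> (b' \<otimes> t)"
      by (auto simp: frac_rel_def)
    note [simp] = m mult_set_carrier
    have "(u \<otimes> w) \<otimes> (a \<otimes> b \<otimes> (s' \<otimes> t')) = (u \<otimes> (a \<otimes> s')) \<otimes> (w \<otimes> (b \<otimes> t'))"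
      by (simp add: m_ac)
    also have "\<dots> = (u \<otimes> w) \<otimes> (a' \<otimes> b' \<otimes> (s \<otimes> t))"
      unfolding u w by (simp add: m_ac)
    finally show "fraction R S (a \<otimes> b) (s \<otimes> t) = fraction R S (a' \<otimes> b') (s' \<otimes> t')"
      using m by (subst fraction_eq_iff) (auto simp: mult_set_mult intro: bexI[of _ "u \<otimes> w"])
  qed
  from UN_equiv_class2[OF equiv_frac_rel equiv_frac_rel this, of "(a, s)" "(b, t)"] assms
  show ?thesis
    by (simp add: localization_def fraction_def case_prod_unfold)
qed

lemma add_fraction:
  assumes "a \<in> carrier R" "s \<in> S" "b \<in> carrier R" "t \<in> S"
  shows "fraction R S a s \<oplus>\<^bsub>localization R S\<^esub> fraction R S b t = fraction R S (a \<otimes> t \<oplus> b \<otimes> s) (s \<otimes> t)"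
proof -
  have "congruent2 (frac_rel R S) (frac_rel R S)
      (\<lambda>x y. fraction R S (fst x \<otimes> snd y \<oplus> fst y \<otimes> snd x) (snd x \<otimes> snd y))"
  proof (rule congruent2I', clarsimp)
    fix a s a' s' b t b' t'
    assume "((a, s), (a', s')) \<in> frac_rel R S" "((b, t), (b', t')) \<in> frac_rel R S"
    then obtain u w where
      m: "a \<in> carrier R" "a' \<in> carrier R" "b \<in> carrier R" "b' \<in> carrier R"
        "s \<in> S" "s' \<in> S" "t \<in> S" "t' \<in> S" "u \<in> S" "w \<in> S"
      and u: "u \<otimes> (a \<otimes> s') = u \<otimes> (a' \<otimes> s)" and w: "w \<otimes> (b \<otimes> t') = w \<otimes> (b' \<otimes> t)"
      by (auto simp: frac_rel_def)
    note [simp] = m mult_set_carrier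
    have "(u \<otimes> w) \<otimes> ((a \<otimes> t \<oplus> b \<otimes> s) \<otimes> (s' \<otimes> t')) =
      (u \<otimes> (a \<otimes> s')) \<otimes> (w \<otimes> t \<otimes> t') \<oplus> (w \<otimes> (b \<otimes> t')) \<otimes> (u \<otimes> s \<otimes> s')"
      by (simp add: m_ac r_distr l_distr)
    also have "\<dots> = (u \<otimes> w) \<otimes> ((a' \<otimes> t' \<oplus> b' \<otimes> s') \<otimes> (s \<otimes> t))"
      unfolding u w by (simp add: m_ac r_distr l_distr)
    finally show "fraction R S (a \<otimes> t \<oplus> b \<otimes> s) (s \<otimes> t) = fraction R S (a' \<otimes> t' \<oplus> b' \<otimes> s') (s' \<otimes> t')"
      using m by (subst fraction_eq_iff) (auto simp: mult_set_mult intro: bexI[of _ "u \<otimes> w"])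
  qed
  from UN_equiv_class2[OF equiv_frac_rel equiv_frac_rel this, of "(a, s)" "(b, t)"] assms
  show ?thesis
    by (simp add: localization_def fraction_def case_prod_unfold)
qed

lemma one_localization: "\<one>\<^bsub>localization R S\<^esub> = fraction R S \<one> \<one>"
  and zero_localization: "\<zero>\<^bsub>localization R S\<^esub> = fraction R S \<zero> \<one>"
  by (simp_all add: localization_def)

lemma cring_localization: "cring (localization R S)"
proof -
  let ?L = "localization R S"
  note simps = mult_set_simps mult_fraction add_fraction one_localization zero_localization fraction_carrier
  have ex: "\<exists>a s. x = fraction R S a s \<and> a \<in> carrier R \<and> s \<in> S" if "x \<in> carrier ?L" for x
    using that by (auto simp: carrier_localization)
  show ?thesis
  proof (rule cringI)
    show "abelian_group ?L"
    proof (rule abelian_groupI)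
      fix x y z assume "x \<in> carrier ?L" "y \<in> carrier ?L" "z \<in> carrier ?L"
      then obtain a s b t c v where [simp]:
        "x = fraction R S a s" "y = fraction R S b t" "z = fraction R S c v"
        "a \<in> carrier R" "s \<in> S" "b \<in> carrier R" "t \<in> S" "c \<in> carrier R" "v \<in> S"
        using ex by metis
      show "x \<oplus>\<^bsub>?L\<^esub> y \<in> carrier ?L" by (simp add: simps)
      show "x \<oplus>\<^bsub>?L\<^esub> y \<oplus>\<^bsub>?L\<^esub> z = x \<oplus>\<^bsub>?L\<^esub> (y \<oplus>\<^bsub>?L\<^esub> z)"
        by (simp add: simps, rule fraction_eqI) (simp_all add: simps m_ac a_ac l_distr r_distr)
      show "x \<oplus>\<^bsub>?L\<^esub> y = y \<oplus>\<^bsub>?L\<^esub> x"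
        by (simp add: simps, rule fraction_eqI) (simp_all add: simps m_ac a_ac l_distr r_distr)
    next
      show "\<zero>\<^bsub>?L\<^esub> \<in> carrier ?L" by (simp add: simps)
    next
      fix x assume "x \<in> carrier ?L"
      then obtain a s where x [simp]: "x = fraction R S a s" "a \<in> carrier R" "s \<in> S"
        using ex by metis
      show "\<zero>\<^bsub>?L\<^esub> \<oplus>\<^bsub>?L\<^esub> x = x" by (simp add: simps)
      have "(\<ominus> a) \<otimes> s \<oplus> a \<otimes> s = \<zero>"
        by (simp add: simps l_minus l_neg)
      then have "fraction R S (\<ominus> a) s \<oplus>\<^bsub>?L\<^esub> x = \<zero>\<^bsub>?L\<^esub>"
        by (simp add: simps) (rule fraction_eqI, simp_all add: simps)
      then show "\<exists>y\<in>carrier ?L. y \<oplus>\<^bsub>?L\<^esub> x = \<zero>\<^bsub>?L\<^esub>"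
        by (intro bexI[of _ "fraction R S (\<ominus> a) s"]) (simp_all add: fraction_carrier)
    qed
    show "comm_monoid ?L"
    proof (rule comm_monoidI)
      fix x y z assume "x \<in> carrier ?L" "y \<in> carrier ?L" "z \<in> carrier ?L"
      then obtain a s b t c v where [simp]:
        "x = fraction R S a s" "y = fraction R S b t" "z = fraction R S c v"
        "a \<in> carrier R" "s \<in> S" "b \<in> carrier R" "t \<in> S" "c \<in> carrier R" "v \<in> S"
        using ex by metis
      show "x \<otimes>\<^bsub>?L\<^esub> y \<in> carrier ?L" by (simp add: simps)
      show "x \<otimes>\<^bsub>?L\<^esub> y \<otimes>\<^bsub>?L\<^esub> z = x \<otimes>\<^bsub>?L\<^esub> (y \<otimes>\<^bsub>?L\<^esub> z)" by (simp add: simps m_ac)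
      show "x \<otimes>\<^bsub>?L\<^esub> y = y \<otimes>\<^bsub>?L\<^esub> x" by (simp add: simps m_ac)
      show "\<one>\<^bsub>?L\<^esub> \<otimes>\<^bsub>?L\<^esub> x = x" by (simp add: simps)
    next
      show "\<one>\<^bsub>?L\<^esub> \<in> carrier ?L" by (simp add: simps)
    qed
    fix x y z assume "x \<in> carrier ?L" "y \<in> carrier ?L" "z \<in> carrier ?L"
    then obtain a s b t c v where [simp]:
      "x = fraction R S a s" "y = fraction R S b t" "z = fraction R S c v"
      "a \<in> carrier R" "s \<in> S" "b \<in> carrier R" "t \<in> S" "c \<in> carrier R" "v \<in> S"
      using ex by metis
    show "(x \<oplus>\<^bsub>?L\<^esub> y) \<otimes>\<^bsub>?L\<^esub> z = x \<otimes>\<^bsub>?L\<^esub> z \<oplus>\<^bsub>?L\<^esub> y \<otimes>\<^bsub>?L\<^esub> z"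
      by (simp add: simps, rule fraction_eqI) (simp_all add: simps m_ac a_ac l_distr r_distr)
  qed
qed

end

end

lemma (in domain) domain_localization:
  assumes S: "submonoid S R" and "\<zero> \<notin> S"
  shows "domain (localization R S)"
proof -
  let ?L = "localization R S"
  note simps = mult_set_simps[OF S] mult_fraction[OF S] one_localization[OF S] zero_localization[OF S]
  interpret L: cring ?L by (rule cring_localization[OF S])
  have fraction_zero: "fraction R S a s = \<zero>\<^bsub>?L\<^esub> \<longleftrightarrow> a = \<zero>" if "a \<in> carrier R" "s \<in> S" for a s
    using that assms(2) integral mult_set_simps[OF S]
    by (auto simp: zero_localization[OF S] fraction_eq_iff[OF S])
  show ?thesis
  proof (rule domain.intro[OF L.is_cring], unfold_locales)
    show "\<one>\<^bsub>?L\<^esub> \<noteq> \<zero>\<^bsub>?L\<^esub>"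
      using fraction_zero[of \<one> \<one>] by (simp add: simps)
    fix x y assume xy: "x \<otimes>\<^bsub>?L\<^esub> y = \<zero>\<^bsub>?L\<^esub>" "x \<in> carrier ?L" "y \<in> carrier ?L"
    then obtain a s b t where [simp]: "x = fraction R S a s" "y = fraction R S b t"
        "a \<in> carrier R" "s \<in> S" "b \<in> carrier R" "t \<in> S"
      by (auto simp: carrier_localization[OF S])
    from xy(1) have "a \<otimes> b = \<zero>"
      using fraction_zero[of "a \<otimes> b" "s \<otimes> t"] by (simp add: simps)
    then show "x = \<zero>\<^bsub>?L\<^esub> \<or> y = \<zero>\<^bsub>?L\<^esub>"
      using integral fraction_zero by auto
  qed
qed

end

theory Submission
  imports Defs
begin

text \<open>
  Every unbalanced atomic equality, read up to units, contains an unbalanced sub-equality all of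
  whose atoms are bad: take a minimal unbalanced one. Call an atom inert if it remains an atom in the
  localization. An equality between products of good or inert atoms is balanced, since an unbalanced
  bad sub-equality would consist of inert atoms only and give two factorizations of different
  lengths in the localization.

  Atoms need not remain atoms in the localization, and may acquire any length there. Factoring an
  atom \<open>a\<close> in the localization and clearing denominators yields \<open>s a = t x\<^sub>1 \<dots> x\<^sub>k\<close> with
  \<open>s, t \<in> S\<close> and inert \<open>x\<^sub>i\<close>. Replacing \<open>s\<close> and \<open>t\<close> by products of good atoms, this equality is
  balanced, because on the left only \<open>a\<close> can be bad and an equality with the single factor \<open>a\<close> on one
  side is balanced. Multiplying such equalities turns any two factorizations of an element into an
  equality between good and inert atoms without changing the difference of the lengths.
\<close>

section \<open>Products over multisets in a commutative monoid\<close>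

text \<open>Multisets replace the indexed families of \<open>atomic_equality\<close>: subproducts
  become submultisets, lengths become sizes, and the order of the factors disappears.\<close>

definition mset_prod :: "('a, 'b) monoid_scheme \<Rightarrow> 'a multiset \<Rightarrow> 'a"
  where "mset_prod G M = (\<Otimes>\<^bsub>G\<^esub>x\<in>set_mset M. x [^]\<^bsub>G\<^esub> count M x)"

context comm_monoid
begin

lemma mset_prod_empty [simp]: "mset_prod G {#} = \<one>"
  by (simp add: mset_prod_def)

lemma mset_prod_closed [simp, intro]: "set_mset M \<subseteq> carrier G \<Longrightarrow> mset_prod G M \<in> carrier G"
  by (auto simp: mset_prod_def intro!: finprod_closed)

lemma mset_prod_add_mset [simp]:
  assumes "x \<in> carrier G" "set_mset M \<subseteq> carrier G"
  shows "mset_prod G (add_mset x M) = x \<otimes> mset_prod G M"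
proof -
  let ?D = "set_mset M - {x}"
  let ?r = "\<Otimes>y\<in>?D. y [^] count M y"
  have D: "(\<lambda>y. y [^] count M y) \<in> ?D \<rightarrow> carrier G" and r: "?r \<in> carrier G"
    using assms by (auto intro!: finprod_closed)
  have set: "set_mset (add_mset x M) = insert x ?D"
    by auto
  have "(\<Otimes>y\<in>?D. y [^] count (add_mset x M) y) = ?r"
    using D by (intro finprod_cong') auto
  moreover have "(\<lambda>y. y [^] count (add_mset x M) y) \<in> ?D \<rightarrow> carrier G"
    using assms by auto
  ultimately have 1: "mset_prod G (add_mset x M) = x [^] Suc (count M x) \<otimes> ?r"
    unfolding mset_prod_def set using assms by (subst finprod_insert) (auto simp del: nat_pow_Suc)
  have 2: "mset_prod G M = x [^] count M x \<otimes> ?r"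
  proof (cases "x \<in># M")
    case True
    then have "set_mset M = insert x ?D"
      by auto
    then have "mset_prod G M = (\<Otimes>y\<in>insert x ?D. y [^] count M y)"
      by (simp only: mset_prod_def)
    also have "\<dots> = x [^] count M x \<otimes> ?r"
      using assms D by (subst finprod_insert) auto
    finally show ?thesis .
  next
    \<comment> \<open>Here \<open>x\<close> has exponent 0 in \<open>M\<close>, and
      \<open>?D\<close> is the whole support.\<close>
    case False
    then show ?thesis
      using r by (simp add: mset_prod_def not_in_iff)
  qed
  show ?thesis
    unfolding 1 2 using assms r by (simp add: m_ac)
qed

lemma mset_prod_union [simp]:
  "\<lbrakk>set_mset M \<subseteq> carrier G; set_mset N \<subseteq> carrier G\<rbrakk> \<Longrightarrow>
    mset_prod G (M + N) = mset_prod G M \<otimes> mset_prod G N"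
  by (induction M) (auto simp: m_assoc)

lemma finprod_eq_mset_prod:
  assumes "finite I" "f \<in> I \<rightarrow> carrier G"
  shows "finprod G f I = mset_prod G (image_mset f (mset_set I))"
  using assms
proof (induction I)
  case (insert i I)
  then have "f ` set_mset (mset_set I) \<subseteq> carrier G"
    by auto
  with insert show ?case
    by simp
qed simp

lemma mult_cong:
  assumes "a \<sim> a'" "b \<sim> b'" "a \<in> carrier G" "a' \<in> carrier G" "b \<in> carrier G" "b' \<in> carrier G"
  shows "a \<otimes> b \<sim> a' \<otimes> b'"
  by (rule associated_trans[OF mult_cong_l mult_cong_r]) (use assms in auto)

lemma finprod_assoc_cong:
  assumes "finite I" "\<And>i. i \<in> I \<Longrightarrow> f i \<in> carrier G \<and> g i \<in> carrier G \<and> f i \<sim> g i"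
  shows "finprod G f I \<sim> finprod G g I"
  using assms
proof (induction I)
  case (insert i I)
  then have "f \<in> I \<rightarrow> carrier G" "g \<in> I \<rightarrow> carrier G"
    by auto
  with insert show ?case
    by (auto intro!: mult_cong)
qed simp

end

lemma ex_image_mset_interval: "\<exists>p. M = image_mset p (mset_set {1..size M})"
proof -
  obtain xs where xs: "mset xs = M"
    using ex_mset by blast
  \<comment> \<open>Families of factors are indexed from 1 and list positions from 0, hence the
    shift.\<close>
  have "image_mset (\<lambda>i. xs ! (i - 1)) (mset_set {1..length xs}) =
      mset (map (\<lambda>i. xs ! (i - 1)) [1..<Suc (length xs)])"
    by (simp only: mset_map mset_upt atLeastLessThanSuc_atLeastAtMost)
  also have "map (\<lambda>i. xs ! (i - 1)) [1..<Suc (length xs)] = xs"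
    by (rule nth_equalityI) (auto simp del: upt_Suc)
  finally show ?thesis
    using xs by (metis size_mset)
qed

section \<open>Associates, units and atoms in a domain\<close>

context domain
begin

lemma atomD: "atom R x \<Longrightarrow> x \<in> carrier R" "atom R x \<Longrightarrow> x \<noteq> \<zero>" "atom R x \<Longrightarrow> x \<notin> Units R"
  by (auto simp: atom_iff)

lemma atom_multD:
  "\<lbrakk>atom R (x \<otimes> y); x \<in> carrier R; y \<in> carrier R\<rbrakk> \<Longrightarrow> x \<in> Units R \<or> y \<in> Units R"
  by (auto simp: atom_iff)

lemma associated_obtain_unit:
  assumes "x \<sim> y" "x \<in> carrier R" "y \<in> carrier R"
  obtains u where "u \<in> Units R" "x = u \<otimes> y"
  using assms ring_associated_iff by blast

lemma unit_mult_associated: "\<lbrakk>u \<in> Units R; x \<in> carrier R\<rbrakk> \<Longrightarrow> u \<otimes> x \<sim> x"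
  using ring_associated_iff[of "u \<otimes> x" x] by auto

lemma associated_lcancel:
  assumes "a \<otimes> b \<sim> a' \<otimes> b'" "a \<sim> a'" "a \<noteq> \<zero>"
    and [simp]: "a \<in> carrier R" "a' \<in> carrier R" "b \<in> carrier R" "b' \<in> carrier R"
  shows "b \<sim> b'"
proof -
  have "a \<otimes> b' \<sim> a' \<otimes> b'"
    using assms(2) by (rule mult_cong_l) simp_all
  with assms(1) have "a \<otimes> b \<sim> a \<otimes> b'"
    by (meson associated_sym associated_trans m_closed assms(4-7))
  then obtain u where u: "u \<in> Units R" "a \<otimes> b = u \<otimes> (a \<otimes> b')"
    by (rule associated_obtain_unit) simp_all
  then have "a \<otimes> b = a \<otimes> (u \<otimes> b')"
    by (simp add: m_lcomm Units_closed)
  then have "b = u \<otimes> b'"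
    using m_lcancel[OF assms(3)] u(1) by (simp add: Units_closed)
  then show ?thesis
    using unit_mult_associated[OF u(1)] by simp
qed

lemma associated_Units_iff:
  "\<lbrakk>x \<sim> y; x \<in> carrier R; y \<in> carrier R\<rbrakk> \<Longrightarrow> x \<in> Units R \<longleftrightarrow> y \<in> Units R"
  using Units_cong associated_sym by blast

lemma mult_Units_iff:
  "\<lbrakk>x \<in> carrier R; y \<in> carrier R\<rbrakk> \<Longrightarrow> x \<otimes> y \<in> Units R \<longleftrightarrow> x \<in> Units R \<and> y \<in> Units R"
  using unit_factor m_comm Units_m_closed by metis

text \<open>The unit linking \<open>x\<close> and \<open>y\<close> is moved into one factor of any
  splitting of \<open>y\<close>; this does not change which factor is a unit.\<close>

lemma atom_associated:
  assumes "atom R x" "x \<sim> y" "y \<in> carrier R"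
  shows "atom R y"
proof -
  note x = atomD[OF assms(1)]
  obtain u where u: "u \<in> Units R" "x = u \<otimes> y"
    using associated_obtain_unit assms x by metis
  have uc: "u \<in> carrier R"
    using u(1) by blast
  have "y \<noteq> \<zero>" "y \<notin> Units R"
    using u x uc by auto
  moreover have "b \<in> Units R \<or> c \<in> Units R" if "y = b \<otimes> c" "b \<in> carrier R" "c \<in> carrier R" for b c
  proof -
    have "x = (u \<otimes> b) \<otimes> c"
      using that u uc by (simp add: m_assoc)
    then have "u \<otimes> b \<in> Units R \<or> c \<in> Units R"
      using assms(1) that uc atom_multD[of "u \<otimes> b" c] by simp
    then show ?thesis
      using that mult_Units_iff[OF uc] by auto
  qed
  ultimately show ?thesis
    using assms(3) by (auto simp: atom_iff)
qed

lemma atoms_subset_carrier: "set_mset M \<subseteq> Collect (atom R) \<Longrightarrow> set_mset M \<subseteq> carrier R"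
  using atomD by auto

lemma mset_prod_atoms_nonzero: "set_mset M \<subseteq> Collect (atom R) \<Longrightarrow> mset_prod R M \<noteq> \<zero>"
proof (induction M)
  case (add x M)
  then have "x \<in> carrier R" "x \<noteq> \<zero>" "set_mset M \<subseteq> carrier R" "mset_prod R M \<noteq> \<zero>"
    using atomD atoms_subset_carrier[of M] by auto
  then show ?case
    using integral[of x "mset_prod R M"] by auto
qed simp

lemma mset_prod_atoms_Units_iff:
  assumes "set_mset M \<subseteq> Collect (atom R)"
  shows "mset_prod R M \<in> Units R \<longleftrightarrow> M = {#}"
proof (cases M)
  case (add x M')
  then have "x \<in> carrier R" "x \<notin> Units R" "set_mset M' \<subseteq> carrier R"
    using assms atomD atoms_subset_carrier[of M'] by auto
  then show ?thesis
    using add mult_Units_iff[of x "mset_prod R M'"] by auto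
qed simp

text \<open>Being an associate of an atom, the product is itself an atom. Splitting off one factor
  therefore leaves a unit, and a product of atoms is a unit only when it is empty.\<close>

lemma size_eq_1_if_associated_atom:
  assumes "atom R a" "a \<sim> mset_prod R M" "set_mset M \<subseteq> Collect (atom R)"
  shows "size M = 1"
proof (cases M)
  case empty
  then show ?thesis
    using assms associated_Units_iff[of a \<one>] atomD by auto
next
  case (add x M')
  then have x: "x \<in> carrier R" "x \<notin> Units R" and M': "set_mset M' \<subseteq> Collect (atom R)"
    using assms atomD by auto
  then have "atom R (x \<otimes> mset_prod R M')"
    using assms add atom_associated[OF assms(1,2)] atoms_subset_carrier by simp
  then have "mset_prod R M' \<in> Units R"
    using x atom_multD[of x] M' atoms_subset_carrier by auto
  then show ?thesis
    using add mset_prod_atoms_Units_iff[OF M'] by simp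
qed

section \<open>Minimal unbalanced equalities and bad atoms\<close>

text \<open>A bridge from multiset products equal up to a unit to the exact equality of indexed
  products that \<open>atomic_equality\<close> demands: \<open>c\<close> enumerates
  \<open>N\<close>, and \<open>b\<close> is \<open>c\<close> with the unit absorbed into one
  factor.\<close>

lemma mset_prod_as_finprod:
  assumes "y \<sim> mset_prod R N" "y \<in> carrier R" "set_mset N \<subseteq> carrier R" "N \<noteq> {#}"
  obtains b c where "N = image_mset c (mset_set {1..size N})"
    "\<And>j. j \<in> {1..size N} \<Longrightarrow> b j \<in> carrier R \<and> c j \<in> carrier R \<and> b j \<sim> c j"
    "finprod R b {1..size N} = y"
proof -
  obtain c where c: "N = image_mset c (mset_set {1..size N})"
    using ex_image_mset_interval by blast
  obtain u where u: "u \<in> Units R" "y = u \<otimes> mset_prod R N"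
    using associated_obtain_unit assms mset_prod_closed by metis
  have uc: "u \<in> carrier R"
    using u by blast
  have "c ` {1..size N} = set_mset N"
    by (subst c) (simp del: size_image_mset)
  then have cc: "c j \<in> carrier R" if "j \<in> {1..size N}" for j
    using that assms(3) by auto
  have split: "{1..size N} = insert 1 {2..size N}"
    using assms(4) by (auto simp: nonempty_has_size)
  \<comment> \<open>Since \<open>N\<close> is nonempty, index 1 is available to carry the
    unit.\<close>
  define b where "b = c(1 := u \<otimes> c 1)"
  have c1: "c 1 \<in> carrier R" and c2: "c \<in> {2..size N} \<rightarrow> carrier R"
    using cc unfolding split by auto
  have "finprod R b {2..size N} = finprod R c {2..size N}"
    using c2 by (intro finprod_cong') (auto simp: b_def)
  moreover have "b \<in> {2..size N} \<rightarrow> carrier R"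
    using c2 by (auto simp: b_def)
  ultimately have "finprod R b {1..size N} = u \<otimes> finprod R c {1..size N}"
    unfolding split using c1 c2 uc by (auto simp: b_def m_assoc)
  also have "finprod R c {1..size N} = mset_prod R N"
    using finprod_eq_mset_prod[of "{1..size N}" c] cc c by auto
  finally have "finprod R b {1..size N} = y"
    using u by simp
  moreover have "b j \<in> carrier R \<and> c j \<in> carrier R \<and> b j \<sim> c j" if "j \<in> {1..size N}" for j
    using cc[OF that] u(1) uc unit_mult_associated by (auto simp: b_def)
  ultimately show thesis
    using that c by blast
qed

text \<open>
  The unit relating the two products is absorbed into the side that does not contain \<open>p\<close>, so that \<open>p\<close>
  itself, and not just an associate of it, is seen to be bad.
\<close>

lemma irredundant_unbalanced_imp_bad:
  assumes M: "set_mset M \<subseteq> Collect (atom R)" "M \<noteq> {#}"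
    and N: "set_mset N \<subseteq> Collect (atom R)" "N \<noteq> {#}"
    and eq: "mset_prod R M \<sim> mset_prod R N" and size: "size M \<noteq> size N"
    and irr: "\<And>M' N'. \<lbrakk>M' \<noteq> {#}; M' \<subset># M; N' \<noteq> {#}; N' \<subset># N\<rbrakk> \<Longrightarrow>
      \<not> mset_prod R M' \<sim> mset_prod R N'"
    and p: "p \<in># M"
  shows "bad_atom R p"
proof -
  note carr = M(1)[THEN atoms_subset_carrier] N(1)[THEN atoms_subset_carrier]
  obtain a where a: "M = image_mset a (mset_set {1..size M})"
    using ex_image_mset_interval by blast
  obtain b c where c: "N = image_mset c (mset_set {1..size N})"
    and bc: "\<And>j. j \<in> {1..size N} \<Longrightarrow> b j \<in> carrier R \<and> c j \<in> carrier R \<and> b j \<sim> c j"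
    and b: "finprod R b {1..size N} = mset_prod R M"
    using mset_prod_as_finprod[OF eq] carr N(2) by (metis mset_prod_closed)
  have ran: "a ` {1..size M} = set_mset M" "c ` {1..size N} = set_mset N"
    using arg_cong[OF a, of set_mset] arg_cong[OF c, of set_mset] by simp_all
  have ac: "a \<in> {1..size M} \<rightarrow> carrier R" and cc: "c \<in> {1..size N} \<rightarrow> carrier R"
    using ran carr by blast+
  have atoms: "\<forall>i\<in>{1..size M}. atom R (a i)" "\<forall>j\<in>{1..size N}. atom R (c j)"
    using ran M(1) N(1) by blast+
  then have "\<forall>j\<in>{1..size N}. atom R (b j)"
    using bc atom_associated associated_sym by blast
  moreover have "finprod R a {1..size M} = mset_prod R M"
    by (rule finprod_eq_mset_prod[OF finite_atLeastAtMost ac, folded a])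
  ultimately have "atomic_equality R (size M) a (size N) b"
    using atoms b M(2) N(2) by (simp add: atomic_equality_def Suc_le_eq nonempty_has_size)
  moreover have "irredundant R (size M) a (size N) b"
    unfolding irredundant_def
  proof (intro allI impI notI, elim conjE)
    fix I J
    assume I: "I \<noteq> {}" "I \<subset> {1..size M}" and J: "J \<noteq> {}" "J \<subset> {1..size N}"
      and assoc: "finprod R a I \<sim> finprod R b J"
    have fin: "finite I" "finite J"
      using I(2) J(2) by (auto intro: finite_subset)
    \<comment> \<open>As \<open>image_mset\<close> preserves size, properness of the index set
      survives even when \<open>f\<close> is not injective.\<close>
    have sub: "image_mset f (mset_set K) \<subset># image_mset f (mset_set {1..n})"
      if "K \<subset> {1..n}" "finite K" for f :: "nat \<Rightarrow> 'a" and K n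
    proof (rule image_mset_subset_mono)
      show "mset_set K \<subset># mset_set {1..n}"
        using that subset_imp_msubset_mset_set[of K "{1..n}"] mset_set_eq_iff[of K "{1..n}"]
        by (auto simp: subset_mset.less_le)
    qed
    have aI: "a \<in> I \<rightarrow> carrier R" and cJ: "c \<in> J \<rightarrow> carrier R" and bJ: "b \<in> J \<rightarrow> carrier R"
      using I(2) J(2) ac cc bc by blast+
    \<comment> \<open>Irredundancy concerns products only up to associates, so \<open>b\<close> may
      be exchanged for \<open>c\<close>, whose index sets correspond to submultisets of
      \<open>N\<close>.\<close>
    have "finprod R b J \<sim> finprod R c J"
      using fin J(2) bc by (intro finprod_assoc_cong) auto
    with assoc have "finprod R a I \<sim> finprod R c J"
      using associated_trans finprod_closed aI cJ by blast
    then have "mset_prod R (image_mset a (mset_set I)) \<sim> mset_prod R (image_mset c (mset_set J))"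
      unfolding finprod_eq_mset_prod[OF fin(1) aI] finprod_eq_mset_prod[OF fin(2) cJ] .
    moreover have "image_mset a (mset_set I) \<subset># M" "image_mset c (mset_set J) \<subset># N"
      by (rule sub[OF I(2) fin(1), of a, folded a], rule sub[OF J(2) fin(2), of c, folded c])
    moreover have "image_mset a (mset_set I) \<noteq> {#}" "image_mset c (mset_set J) \<noteq> {#}"
      using I J fin by (auto simp: mset_set_empty_iff)
    ultimately show False
      using irr by blast
  qed
  ultimately show ?thesis
    using size p ran unfolding bad_atom_def by blast
qed

text \<open>Descent on the length of the left side. If no proper subproducts match, every atom is
  bad by \<open>irredundant_unbalanced_imp_bad\<close>. Otherwise the matching part is cancelled;
  lengths add over the two resulting equalities, so at least one of them is unbalanced, and both
  have a shorter left side.\<close>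

lemma unbalanced_imp_bad_subequality:
  assumes "set_mset M \<subseteq> Collect (atom R)" "set_mset N \<subseteq> Collect (atom R)"
    and "mset_prod R M \<sim> mset_prod R N" "size M \<noteq> size N"
  shows "\<exists>M' N'. M' \<subseteq># M \<and> N' \<subseteq># N \<and> (\<forall>x\<in>#M' + N'. bad_atom R x) \<and>
    mset_prod R M' \<sim> mset_prod R N' \<and> size M' \<noteq> size N'"
  using assms
proof (induction "size M" arbitrary: M N rule: less_induct)
  case less
  note M = less.prems(1) and N = less.prems(2) and eq = less.prems(3) and size = less.prems(4)
  note carr = M[THEN atoms_subset_carrier] N[THEN atoms_subset_carrier]
  \<comment> \<open>If one side were empty, both products would be units, so both sides would be
    empty and the sizes equal.\<close>
  have ne: "M \<noteq> {#}" "N \<noteq> {#}"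
    using associated_Units_iff[OF eq] carr mset_prod_atoms_Units_iff[OF M]
      mset_prod_atoms_Units_iff[OF N] size by auto
  show ?case
  proof (cases "\<exists>M' N'. M' \<noteq> {#} \<and> M' \<subset># M \<and> N' \<noteq> {#} \<and> N' \<subset># N \<and>
      mset_prod R M' \<sim> mset_prod R N'")
    case False
    then have "bad_atom R x" if "x \<in># M" for x
      using irredundant_unbalanced_imp_bad[OF M ne(1) N ne(2) eq size] that by blast
    moreover have "bad_atom R x" if "x \<in># N" for x
      using irredundant_unbalanced_imp_bad[OF N ne(2) M ne(1) associated_sym[OF eq]]
        False size that associated_sym by metis
    ultimately show ?thesis
      using eq size by (intro exI[of _ M] exI[of _ N]) auto
  next
    case True
    then obtain M' N' where M': "M' \<noteq> {#}" "M' \<subset># M" and N': "N' \<noteq> {#}" "N' \<subset># N"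
      and eq': "mset_prod R M' \<sim> mset_prod R N'"
      by blast
    define M'' N'' where "M'' = M - M'" and "N'' = N - N'"
    have split: "M = M' + M''" "N = N' + N''"
      using M' N' by (simp_all add: M''_def N''_def subset_mset.less_imp_le)
    have "M'' \<noteq> {#}"
      using M'(2) split by auto
    then have less': "size M' < size M" "size M'' < size M"
      using M'(1) split by (simp_all add: nonempty_has_size)
    have atoms: "set_mset M' \<subseteq> Collect (atom R)" "set_mset N' \<subseteq> Collect (atom R)"
      "set_mset M'' \<subseteq> Collect (atom R)" "set_mset N'' \<subseteq> Collect (atom R)"
      using M N split by auto
    note carr' = atoms[THEN atoms_subset_carrier]
    have "mset_prod R M' \<otimes> mset_prod R M'' \<sim> mset_prod R N' \<otimes> mset_prod R N''"
      using eq carr' unfolding split by simp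
    then have eq'': "mset_prod R M'' \<sim> mset_prod R N''"
      by (rule associated_lcancel[OF _ eq' mset_prod_atoms_nonzero[OF atoms(1)]])
        (use carr' in blast)+
    have "size M' \<noteq> size N' \<or> size M'' \<noteq> size N''"
      using size unfolding split by auto
    then show ?thesis
    proof
      assume "size M' \<noteq> size N'"
      from less.hyps[OF less'(1) atoms(1,2) eq' this] show ?thesis
        using M'(2) N'(2) by (meson subset_mset.less_imp_le subset_mset.order_trans)
    next
      assume "size M'' \<noteq> size N''"
      from less.hyps[OF less'(2) atoms(3,4) eq'' this] show ?thesis
        unfolding M''_def N''_def by (meson diff_subset_eq_self subset_mset.order_trans)
    qed
  qed
qed

section \<open>Factorizations and half-factoriality in terms of multisets\<close>

lemma atomic_factorization_iff_mset:
  "(\<exists>p. atomic_factorization R n p x) \<longleftrightarrow>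
    (\<exists>M. set_mset M \<subseteq> Collect (atom R) \<and> size M = n \<and> x = mset_prod R M)"
proof
  assume "\<exists>p. atomic_factorization R n p x"
  then obtain p where p: "\<forall>i\<in>{1..n}. atom R (p i)" "x = finprod R p {1..n}"
    by (auto simp: atomic_factorization_def)
  then have "p \<in> {1..n} \<rightarrow> carrier R"
    using atomD by auto
  with p show "\<exists>M. set_mset M \<subseteq> Collect (atom R) \<and> size M = n \<and> x = mset_prod R M"
    by (intro exI[of _ "image_mset p (mset_set {1..n})"]) (auto simp: finprod_eq_mset_prod)
next
  assume "\<exists>M. set_mset M \<subseteq> Collect (atom R) \<and> size M = n \<and> x = mset_prod R M"
  then obtain M where M: "set_mset M \<subseteq> Collect (atom R)" "size M = n" "x = mset_prod R M"
    by blast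
  obtain p where p: "M = image_mset p (mset_set {1..n})"
    using ex_image_mset_interval M(2) by blast
  then have "p ` {1..n} = set_mset M"
    by simp
  then have atoms: "\<forall>i\<in>{1..n}. atom R (p i)"
    using M(1) by blast
  then have "p \<in> {1..n} \<rightarrow> carrier R"
    using atomD by auto
  then have "x = finprod R p {1..n}"
    using M(3) p by (simp add: finprod_eq_mset_prod)
  with atoms show "\<exists>p. atomic_factorization R n p x"
    by (auto simp: atomic_factorization_def)
qed

end

lemma (in atomic_domain) ex_atom_mset:
  assumes "x \<in> carrier R" "x \<noteq> \<zero>" "x \<notin> Units R"
  shows "\<exists>M. set_mset M \<subseteq> Collect (atom R) \<and> x = mset_prod R M"
  using atomic[OF assms] atomic_factorization_iff_mset by blast

text \<open>Since \<open>half_factorial\<close> compares factorizations of one and the same nonzero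
  nonunit, the unit linking the products is absorbed into an atom of \<open>M\<close>. An empty
  \<open>M\<close> is treated apart: its product is a unit, which forces \<open>N\<close> to be
  empty.\<close>

lemma (in half_factorial_domain) size_eq_if_associated:
  assumes M: "set_mset M \<subseteq> Collect (atom R)" and N: "set_mset N \<subseteq> Collect (atom R)"
    and eq: "mset_prod R M \<sim> mset_prod R N"
  shows "size M = size N"
proof (cases M)
  case empty
  then show ?thesis
    using associated_Units_iff[OF eq] mset_prod_atoms_Units_iff[OF N] N atoms_subset_carrier by auto
next
  case (add m M')
  note carr = M[THEN atoms_subset_carrier] N[THEN atoms_subset_carrier]
  have m: "atom R m" "m \<in> carrier R" "set_mset M' \<subseteq> carrier R"
    using M add carr by auto
  obtain u where u: "u \<in> Units R" "mset_prod R N = u \<otimes> mset_prod R M"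
    using associated_obtain_unit[OF associated_sym[OF eq]] carr by blast
  have uc: "u \<in> carrier R"
    using u(1) by blast
  have "m \<sim> u \<otimes> m"
    using unit_mult_associated u(1) m(2) associated_sym by blast
  then have um: "atom R (u \<otimes> m)"
    using atom_associated m uc by simp
  have eq': "mset_prod R N = mset_prod R (add_mset (u \<otimes> m) M')"
    using u(2) uc m add by (simp add: m_assoc)
  have x: "mset_prod R N \<in> carrier R" "mset_prod R N \<noteq> \<zero>" "mset_prod R N \<notin> Units R"
    using carr mset_prod_atoms_nonzero[OF N] associated_Units_iff[OF eq]
      mset_prod_atoms_Units_iff[OF M] add by auto
  have "\<exists>p. atomic_factorization R (size M) p (mset_prod R N)"
    unfolding atomic_factorization_iff_mset
    by (rule exI[of _ "add_mset (u \<otimes> m) M'"]) (use eq' um M add in auto)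
  moreover have "\<exists>p. atomic_factorization R (size N) p (mset_prod R N)"
    unfolding atomic_factorization_iff_mset using N by blast
  ultimately show ?thesis
    using half_factorial[OF x] by blast
qed

lemma (in atomic_domain) half_factorial_domainI:
  assumes "\<And>M N. \<lbrakk>set_mset M \<subseteq> Collect (atom R); set_mset N \<subseteq> Collect (atom R);
    mset_prod R M = mset_prod R N\<rbrakk> \<Longrightarrow> size M = size N"
  shows "half_factorial_domain R"
proof (unfold_locales)
  fix x n p m q
  assume "atomic_factorization R n p x" "atomic_factorization R m q x"
  then show "n = m"
    using assms atomic_factorization_iff_mset by metis
qed

section \<open>Units, associates and denominators in the localization\<close>

locale half_factorial_localization = domain +
  fixes S
  assumes saturated: "saturated_mult_set R S"
    and half_factorial_localization: "half_factorial_domain (localization R S)"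
begin

abbreviation L where "L \<equiv> localization R S"

abbreviation embed where "embed a \<equiv> fraction R S a \<one>"

interpretation L: half_factorial_domain L
  by (rule half_factorial_localization)

lemma S_submonoid: "submonoid S R"
  using saturated by (simp add: saturated_mult_set_def)

lemmas S_simps [simp] = mult_set_simps[OF S_submonoid]

lemma S_divisor: "\<lbrakk>a \<otimes> b \<in> S; a \<in> carrier R; b \<in> carrier R\<rbrakk> \<Longrightarrow> a \<in> S"
  using saturated dividesI[OF _ refl, of b R a] unfolding saturated_mult_set_def by blast

lemma Units_subset_S: "u \<in> Units R \<Longrightarrow> u \<in> S"
  using S_divisor[of u "inv u"] by auto

text \<open>Otherwise the fractions for \<one> and \<zero> would coincide, but \<open>L\<close> is a
  domain.\<close>

lemma zero_notin_S: "\<zero> \<notin> S"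
proof
  assume "\<zero> \<in> S"
  then have "embed \<one> = embed \<zero>"
    by (auto simp: fraction_eq_iff[OF S_submonoid])
  then show False
    using L.one_not_zero by (simp add: one_localization[OF S_submonoid] zero_localization[OF S_submonoid])
qed

lemma S_nonzero: "s \<in> S \<Longrightarrow> s \<noteq> \<zero>"
  using zero_notin_S by blast

lemma fraction_eq:
  assumes "a \<in> carrier R" "s \<in> S" "b \<in> carrier R" "t \<in> S"
  shows "fraction R S a s = fraction R S b t \<longleftrightarrow> a \<otimes> t = b \<otimes> s"
proof -
  have "u \<otimes> (a \<otimes> t) = u \<otimes> (b \<otimes> s) \<longleftrightarrow> a \<otimes> t = b \<otimes> s" if "u \<in> S" for u
    using that assms by (intro m_lcancel) (auto simp: S_nonzero)
  then show ?thesis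
    using fraction_eq_iff[OF S_submonoid assms] S_simps(2) by blast
qed

lemma embed_closed [simp]: "a \<in> carrier R \<Longrightarrow> embed a \<in> carrier L"
  by (simp add: fraction_carrier[OF S_submonoid])

lemma embed_mult [simp]:
  "\<lbrakk>a \<in> carrier R; b \<in> carrier R\<rbrakk> \<Longrightarrow> embed (a \<otimes> b) = embed a \<otimes>\<^bsub>L\<^esub> embed b"
  by (simp add: mult_fraction[OF S_submonoid])

lemma embed_one [simp]: "embed \<one> = \<one>\<^bsub>L\<^esub>"
  by (simp add: one_localization[OF S_submonoid])

lemma embed_eq_zero_iff: "a \<in> carrier R \<Longrightarrow> embed a = \<zero>\<^bsub>L\<^esub> \<longleftrightarrow> a = \<zero>"
  by (simp add: zero_localization[OF S_submonoid] fraction_eq)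

lemma embed_mset_prod:
  "set_mset M \<subseteq> carrier R \<Longrightarrow> embed (mset_prod R M) = mset_prod L (image_mset embed M)"
proof (induction M)
  case (add x M)
  then have "set_mset (image_mset embed M) \<subseteq> carrier L"
    by auto
  with add show ?case
    by simp
qed simp

lemma fraction_one_Units:
  assumes "s \<in> S"
  shows "fraction R S \<one> s \<in> Units L"
proof -
  have "fraction R S \<one> s \<otimes>\<^bsub>L\<^esub> embed s = \<one>\<^bsub>L\<^esub>"
    using assms by (simp add: mult_fraction[OF S_submonoid] one_localization[OF S_submonoid] fraction_eq del: embed_one)
  moreover have "fraction R S \<one> s \<in> carrier L"
    using assms by (simp add: fraction_carrier[OF S_submonoid])
  ultimately show ?thesis
    using assms L.mult_Units_iff[of "fraction R S \<one> s" "embed s"] by simp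
qed

lemma fraction_associated:
  assumes "a \<in> carrier R" "s \<in> S"
  shows "fraction R S a s \<sim>\<^bsub>L\<^esub> embed a"
proof -
  have "fraction R S \<one> s \<otimes>\<^bsub>L\<^esub> embed a = fraction R S a s"
    using assms by (simp add: mult_fraction[OF S_submonoid])
  then show ?thesis
    using L.unit_mult_associated[OF fraction_one_Units[OF assms(2)], of "embed a"] assms by simp
qed

lemma associated_embed_obtain:
  assumes "y \<in> carrier L"
  obtains a where "a \<in> carrier R" "y \<sim>\<^bsub>L\<^esub> embed a"
proof -
  obtain a s where "a \<in> carrier R" "s \<in> S" "y = fraction R S a s"
    using assms by (auto simp: carrier_localization[OF S_submonoid])
  then show thesis
    using that fraction_associated by blast
qed

text \<open>Saturation gives the forward direction: an inverse \<open>b / t\<close> of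
  \<open>a / 1\<close> yields \<open>a \<otimes> b = t\<close>, so \<open>a\<close> divides an
  element of \<open>S\<close>.\<close>

lemma embed_Units_iff:
  assumes "a \<in> carrier R"
  shows "embed a \<in> Units L \<longleftrightarrow> a \<in> S"
proof
  assume "a \<in> S"
  then have "fraction R S \<one> a \<otimes>\<^bsub>L\<^esub> embed a = \<one>\<^bsub>L\<^esub>"
    by (simp add: mult_fraction[OF S_submonoid] one_localization[OF S_submonoid] fraction_eq del: embed_one)
  then show "embed a \<in> Units L"
    using L.mult_Units_iff[of "fraction R S \<one> a" "embed a"] \<open>a \<in> S\<close> assms
    by (simp add: fraction_carrier[OF S_submonoid])
next
  assume a: "embed a \<in> Units L"
  then have "inv\<^bsub>L\<^esub> (embed a) \<in> carrier L"
    by simp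
  then obtain b t where b: "inv\<^bsub>L\<^esub> (embed a) = fraction R S b t" "b \<in> carrier R" "t \<in> S"
    by (auto simp: carrier_localization[OF S_submonoid])
  have "embed a \<otimes>\<^bsub>L\<^esub> fraction R S b t = \<one>\<^bsub>L\<^esub>"
    using a b by (metis L.Units_r_inv)
  then have "a \<otimes> b \<in> S"
    using assms b by (simp add: mult_fraction[OF S_submonoid] one_localization[OF S_submonoid] fraction_eq del: embed_one)
  then show "a \<in> S"
    using S_divisor assms b by blast
qed

text \<open>This clears denominators: the unit linking the two images is a fraction
  \<open>t / s\<close>, and its numerator lies in \<open>S\<close> because the image of
  \<open>t\<close> is again a unit of \<open>L\<close>.\<close>

lemma embed_associated_obtain:
  assumes "embed a \<sim>\<^bsub>L\<^esub> embed b" "a \<in> carrier R" "b \<in> carrier R"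
  obtains s t where "s \<in> S" "t \<in> S" "s \<otimes> a = t \<otimes> b"
proof -
  obtain u where u: "u \<in> Units L" "embed a = u \<otimes>\<^bsub>L\<^esub> embed b"
    using L.associated_obtain_unit assms embed_closed by metis
  then have "u \<in> carrier L"
    by blast
  then obtain t s where t: "u = fraction R S t s" "t \<in> carrier R" "s \<in> S"
    by (auto simp: carrier_localization[OF S_submonoid])
  have "embed t \<in> Units L"
    using L.associated_Units_iff[OF fraction_associated[OF t(2,3)]] u t
    by (simp add: fraction_carrier[OF S_submonoid])
  then have "t \<in> S"
    using embed_Units_iff t by blast
  moreover have "s \<otimes> a = t \<otimes> b"
    using u(2) t assms by (simp add: mult_fraction[OF S_submonoid] fraction_eq m_comm)
  ultimately show thesis
    using that t by blast
qed

section \<open>Atoms of \<open>L\<close> and inert atoms of \<open>R\<close>\<close>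

definition inert_atom
  where "inert_atom x \<longleftrightarrow> atom R x \<and> atom L (embed x)"

text \<open>An atom of \<open>L\<close> has only one nonunit factor, so all but one of the atoms in
  \<open>M\<close> become units of \<open>L\<close> and hence lie in \<open>S\<close>, while the
  remaining one stays an atom. The induction peels off factors until that one is met.\<close>

lemma embed_atom_mset_prod:
  assumes "set_mset M \<subseteq> Collect (atom R)" "atom L (embed (mset_prod R M))"
  shows "\<exists>s\<in>S. \<exists>x. inert_atom x \<and> mset_prod R M = s \<otimes> x"
  using assms
proof (induction M)
  \<comment> \<open>The empty product is a unit of \<open>L\<close>, hence not an atom.\<close>
  case empty
  then show ?case
    using L.atomD(3)[of "\<one>\<^bsub>L\<^esub>"] by simp
next
  case (add x M)
  then have x: "atom R x" "x \<in> carrier R" and M: "set_mset M \<subseteq> Collect (atom R)" "set_mset M \<subseteq> carrier R"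
    using atomD by auto
  then have prod: "mset_prod R M \<in> carrier R"
    by simp
  have at: "atom L (embed x \<otimes>\<^bsub>L\<^esub> embed (mset_prod R M))"
    using add.prems x M prod by simp
  then consider "embed x \<in> Units L" | "embed (mset_prod R M) \<in> Units L"
    using L.atom_multD x prod embed_closed by blast
  then show ?case
  proof cases
    case 1
    then have "atom L (embed (mset_prod R M))"
      using L.atom_associated[OF at L.unit_mult_associated] prod by simp
    then obtain s y where s: "s \<in> S" "inert_atom y" "mset_prod R M = s \<otimes> y"
      using add.IH M by blast
    then have "mset_prod R (add_mset x M) = (x \<otimes> s) \<otimes> y"
      using x M atomD[of y] by (simp add: inert_atom_def m_assoc)
    moreover have "x \<otimes> s \<in> S"
      using 1 embed_Units_iff x s by simp
    ultimately show ?thesis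
      using s by blast
  next
    case 2
    then have "atom L (embed x)"
      using L.atom_associated[of _ "embed x"] at L.unit_mult_associated prod x
      by (metis L.m_comm embed_closed)
    then have "inert_atom x"
      using x by (simp add: inert_atom_def)
    moreover have "mset_prod R M \<in> S"
      using 2 embed_Units_iff prod by simp
    ultimately show ?thesis
      using mset_prod_add_mset[OF x(2) M(2)] m_comm[OF x(2) prod] by metis
  qed
qed

end

section \<open>Clearing denominators in factorizations over \<open>L\<close>\<close>

locale atomic_half_factorial_localization = atomic_domain + half_factorial_localization +
  assumes good: "\<lbrakk>x \<in> S; x \<notin> Units R\<rbrakk> \<Longrightarrow>
    \<exists>n p. (\<forall>i\<in>{1..n::nat}. good_atom R (p i)) \<and> x = (\<Otimes>i\<in>{1..n}. p i)"
begin

interpretation L: half_factorial_domain L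
  by (rule half_factorial_localization)

lemma embed_atom_split:
  assumes "c \<in> carrier R" "atom L (embed c)"
  shows "\<exists>s\<in>S. \<exists>x. inert_atom x \<and> c = s \<otimes> x"
proof -
  have "c \<noteq> \<zero>" "c \<notin> Units R"
    using assms L.atomD embed_eq_zero_iff embed_Units_iff Units_subset_S by blast+
  then show ?thesis
    using ex_atom_mset[OF assms(1)] embed_atom_mset_prod assms by blast
qed

text \<open>Every atom of \<open>L\<close> is associated to the image of some
  \<open>w \<otimes> x\<close> with \<open>w \<in> S\<close> and \<open>x\<close> inert, so the
  atoms in \<open>Y\<close> are traded one by one for inert ones. The element \<open>a\<close> is
  arbitrary in the induction because the hypothesis is applied to the numerator \<open>d\<close> of
  the remaining product.\<close>

lemma associated_mset_prod_split:
  assumes "set_mset Y \<subseteq> Collect (atom L)" "a \<in> carrier R" "embed a \<sim>\<^bsub>L\<^esub> mset_prod L Y"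
  shows "\<exists>s\<in>S. \<exists>t\<in>S. \<exists>X. set_mset X \<subseteq> Collect inert_atom \<and> s \<otimes> a = t \<otimes> mset_prod R X"
  using assms
proof (induction Y arbitrary: a)
  case empty
  then have "a \<in> S"
    using embed_Units_iff L.associated_Units_iff[of "embed a" "\<one>\<^bsub>L\<^esub>"] by simp
  then show ?case
    by (intro bexI[of _ \<one>] bexI[of _ a] exI[of _ "{#}"]) auto
next
  case (add y Y)
  then have y: "atom L y" "y \<in> carrier L" and Y: "set_mset Y \<subseteq> Collect (atom L)" "set_mset Y \<subseteq> carrier L"
    using L.atomD by auto
  then have prod: "mset_prod L Y \<in> carrier L"
    by simp
  obtain c where c: "c \<in> carrier R" "y \<sim>\<^bsub>L\<^esub> embed c"
    using associated_embed_obtain y by blast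
  obtain d where d: "d \<in> carrier R" "mset_prod L Y \<sim>\<^bsub>L\<^esub> embed d"
    using associated_embed_obtain prod by blast
  obtain w x where w: "w \<in> S" "inert_atom x" "c = w \<otimes> x"
    using embed_atom_split[OF c(1)] L.atom_associated[OF y(1) c(2)] c by auto
  obtain s t X where IH: "s \<in> S" "t \<in> S" "set_mset X \<subseteq> Collect inert_atom"
      "s \<otimes> d = t \<otimes> mset_prod R X"
    using add.IH[OF Y(1) d(1) L.associated_sym[OF d(2)]] by blast
  have x: "x \<in> carrier R" and X: "set_mset X \<subseteq> carrier R"
    using w IH atomD by (auto simp: inert_atom_def)
  have "embed a \<sim>\<^bsub>L\<^esub> y \<otimes>\<^bsub>L\<^esub> mset_prod L Y"
    using add.prems(3) y Y by simp
  moreover have "y \<otimes>\<^bsub>L\<^esub> mset_prod L Y \<sim>\<^bsub>L\<^esub> embed c \<otimes>\<^bsub>L\<^esub> embed d"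
    using c d y prod by (intro L.mult_cong) auto
  ultimately have "embed a \<sim>\<^bsub>L\<^esub> embed (c \<otimes> d)"
    using L.associated_trans[of "embed a" "y \<otimes>\<^bsub>L\<^esub> mset_prod L Y"] add.prems(2) c d by simp
  then obtain s' t' where s': "s' \<in> S" "t' \<in> S" "s' \<otimes> a = t' \<otimes> (c \<otimes> d)"
    using embed_associated_obtain add.prems(2) c d m_closed by metis
  have [simp]: "a \<in> carrier R" "d \<in> carrier R" "x \<in> carrier R" "mset_prod R X \<in> carrier R"
    "s \<in> carrier R" "t \<in> carrier R" "s' \<in> carrier R" "t' \<in> carrier R" "w \<in> carrier R"
    using add.prems(2) d x X IH s' w by auto
  \<comment> \<open>The extra multiplier \<open>s\<close> makes \<open>s \<otimes> d\<close> appear,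
    which the induction hypothesis rewrites; the elements of \<open>S\<close> are gathered in
    front.\<close>
  have "(s \<otimes> s') \<otimes> a = s \<otimes> (s' \<otimes> a)"
    by (simp add: m_assoc)
  also have "\<dots> = t' \<otimes> w \<otimes> x \<otimes> (s \<otimes> d)"
    unfolding s'(3) w(3) by (simp add: m_ac)
  also have "\<dots> = (t' \<otimes> w \<otimes> t) \<otimes> mset_prod R (add_mset x X)"
    unfolding IH(4) using X by (simp add: m_ac)
  finally show ?case
    using s' w IH
    by (intro bexI[of _ "s \<otimes> s'"] bexI[of _ "t' \<otimes> w \<otimes> t"] exI[of _ "add_mset x X"]) auto
qed

text \<open>Atomicity of \<open>L\<close> supplies the atoms; an element that becomes a unit of
  \<open>L\<close> is matched with the empty multiset.\<close>

lemma nonzero_split: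
  assumes "a \<in> carrier R" "a \<noteq> \<zero>"
  shows "\<exists>s\<in>S. \<exists>t\<in>S. \<exists>X. set_mset X \<subseteq> Collect inert_atom \<and> s \<otimes> a = t \<otimes> mset_prod R X"
proof -
  have "\<exists>Y. set_mset Y \<subseteq> Collect (atom L) \<and> embed a \<sim>\<^bsub>L\<^esub> mset_prod L Y"
  proof (cases "embed a \<in> Units L")
    case True
    then show ?thesis
      by (intro exI[of _ "{#}"]) (simp add: L.Units_assoc)
  next
    case False
    then show ?thesis
      using L.ex_atom_mset[of "embed a"] assms embed_eq_zero_iff embed_closed L.associated_refl by metis
  qed
  then show ?thesis
    using associated_mset_prod_split assms by blast
qed

text \<open>Stated up to associates so that the units in \<open>S\<close> are covered by the empty
  multiset.\<close>

lemma S_associated_good: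
  assumes "s \<in> S"
  shows "\<exists>P. set_mset P \<subseteq> Collect (good_atom R) \<and> s \<sim> mset_prod R P"
proof (cases "s \<in> Units R")
  case True
  then show ?thesis
    by (intro exI[of _ "{#}"]) (simp add: Units_assoc)
next
  case False
  then obtain n :: nat and p where p: "\<forall>i\<in>{1..n}. good_atom R (p i)" "s = finprod R p {1..n}"
    using good assms by blast
  then have "p \<in> {1..n} \<rightarrow> carrier R"
    using atomD by (auto simp: good_atom_def)
  then have "s = mset_prod R (image_mset p (mset_set {1..n}))"
    using p by (simp add: finprod_eq_mset_prod)
  then show ?thesis
    using p(1) assms by (intro exI[of _ "image_mset p (mset_set {1..n})"]) auto
qed

lemma good_imp_atom: "set_mset P \<subseteq> Collect (good_atom R) \<Longrightarrow> set_mset P \<subseteq> Collect (atom R)"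
  by (auto simp: good_atom_def)

lemma inert_imp_atom: "set_mset X \<subseteq> Collect inert_atom \<Longrightarrow> set_mset X \<subseteq> Collect (atom R)"
  by (auto simp: inert_atom_def)

section \<open>Equalities that are forced to be balanced\<close>

text \<open>Units of \<open>R\<close> stay units in \<open>L\<close>, so the relation passes to
  \<open>L\<close>, where the images are atoms and half-factoriality fixes the length.\<close>

lemma size_eq_if_inert:
  assumes M: "set_mset M \<subseteq> Collect inert_atom" and N: "set_mset N \<subseteq> Collect inert_atom"
    and eq: "mset_prod R M \<sim> mset_prod R N"
  shows "size M = size N"
proof -
  have carr: "set_mset M \<subseteq> carrier R" "set_mset N \<subseteq> carrier R"
    using M N inert_imp_atom atoms_subset_carrier by auto
  then obtain u where u: "u \<in> Units R" "mset_prod R M = u \<otimes> mset_prod R N"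
    using associated_obtain_unit eq mset_prod_closed by metis
  then have "embed u \<in> Units L"
    using embed_Units_iff Units_subset_S by blast
  then have "embed (mset_prod R M) \<sim>\<^bsub>L\<^esub> embed (mset_prod R N)"
    using u carr L.unit_mult_associated by (simp add: Units_closed)
  then have "size (image_mset embed M) = size (image_mset embed N)"
    using M N carr by (intro L.size_eq_if_associated) (auto simp: embed_mset_prod inert_atom_def)
  then show ?thesis
    by simp
qed

lemma size_eq_if_good_or_inert:
  assumes M: "set_mset M \<subseteq> {x. good_atom R x \<or> inert_atom x}"
    and N: "set_mset N \<subseteq> {x. good_atom R x \<or> inert_atom x}"
    and eq: "mset_prod R M \<sim> mset_prod R N"
  shows "size M = size N"
proof (rule ccontr)
  assume "size M \<noteq> size N"
  moreover have "set_mset M \<subseteq> Collect (atom R)" "set_mset N \<subseteq> Collect (atom R)"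
    using M N by (auto simp: good_atom_def inert_atom_def)
  ultimately obtain M' N' where sub: "M' \<subseteq># M" "N' \<subseteq># N" and bad: "\<forall>x\<in>#M' + N'. bad_atom R x"
    and eq': "mset_prod R M' \<sim> mset_prod R N'" and size: "size M' \<noteq> size N'"
    using unbalanced_imp_bad_subequality eq by meson
  \<comment> \<open>No atom is both good and bad, so every atom of the bad sub-equality is
    inert.\<close>
  have "set_mset M' \<subseteq> Collect inert_atom" "set_mset N' \<subseteq> Collect inert_atom"
    using M N bad set_mset_mono[OF sub(1)] set_mset_mono[OF sub(2)] by (auto simp: good_atom_def)
  then show False
    using size_eq_if_inert eq' size by blast
qed

lemma atom_good_mset_balanced:
  assumes a: "atom R a" and P: "set_mset P \<subseteq> Collect (good_atom R)"
    and N: "set_mset N \<subseteq> Collect (atom R)"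
    and eq: "mset_prod R (add_mset a P) \<sim> mset_prod R N"
  shows "Suc (size P) = size N"
proof (rule ccontr)
  assume "Suc (size P) \<noteq> size N"
  then have "size (add_mset a P) \<noteq> size N"
    by simp
  moreover have "set_mset (add_mset a P) \<subseteq> Collect (atom R)"
    using a P good_imp_atom by auto
  ultimately obtain M' N' where sub: "M' \<subseteq># add_mset a P" "N' \<subseteq># N"
    and bad: "\<forall>x\<in>#M' + N'. bad_atom R x"
    and eq': "mset_prod R M' \<sim> mset_prod R N'" and size: "size M' \<noteq> size N'"
    using unbalanced_imp_bad_subequality N eq by meson
  have N': "set_mset N' \<subseteq> Collect (atom R)"
    using N set_mset_mono[OF sub(2)] by auto
  note cN' = atoms_subset_carrier[OF N']
  have "M' = {#} \<or> M' = {#a#}"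
  proof -
    \<comment> \<open>A bad atom cannot lie in \<open>P\<close>, so an atom of \<open>M'\<close> can
      only be the added copy of \<open>a\<close>. The multiplicity of \<open>a\<close> itself is
      also at most 1: if \<open>a\<close> occurs in \<open>M'\<close>, it is bad and hence absent
      from \<open>P\<close>.\<close>
    have "count M' x \<le> count {#a#} x" for x
    proof (cases "x \<in># M'")
      case True
      then have "x \<notin># P"
        using bad P by (auto simp: good_atom_def)
      then show ?thesis
        using mset_subset_eq_count[OF sub(1), of x] by (simp add: not_in_iff split: if_splits)
    qed (simp add: not_in_iff)
    then have "M' \<subseteq># {#a#}"
      by (rule mset_subset_eqI)
    then show ?thesis
      by (cases M') (auto simp: insert_subset_eq_iff)
  qed
  then show False
  proof
    assume "M' = {#}"
    then show False
      using eq' size associated_Units_iff[OF eq'] mset_prod_atoms_Units_iff[OF N'] cN' by auto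
  next
    assume "M' = {#a#}"
    then show False
      using size_eq_1_if_associated_atom[OF a _ N'] eq' size atomD(1)[OF a] by auto
  qed
qed

section \<open>Trading arbitrary atoms for good and inert ones\<close>

lemma atom_balanced_split:
  assumes a: "atom R a"
  shows "\<exists>P Q X. set_mset P \<subseteq> Collect (good_atom R) \<and> set_mset Q \<subseteq> Collect (good_atom R) \<and>
    set_mset X \<subseteq> Collect inert_atom \<and> mset_prod R (P + {#a#}) \<sim> mset_prod R (Q + X) \<and>
    size (P + {#a#}) = size (Q + X)"
proof -
  note ac = atomD[OF a]
  obtain s t X where s: "s \<in> S" "t \<in> S" "set_mset X \<subseteq> Collect inert_atom" "s \<otimes> a = t \<otimes> mset_prod R X"
    using nonzero_split ac by blast
  \<comment> \<open>The products over \<open>P\<close> and \<open>Q\<close> replace the multipliers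
    \<open>s\<close> and \<open>t\<close>; this loses only units, which do not affect relations up
    to associates.\<close>
  obtain P Q where P: "set_mset P \<subseteq> Collect (good_atom R)" "s \<sim> mset_prod R P"
    and Q: "set_mset Q \<subseteq> Collect (good_atom R)" "t \<sim> mset_prod R Q"
    using S_associated_good s by meson
  have carr [simp]: "set_mset P \<subseteq> carrier R" "set_mset Q \<subseteq> carrier R" "set_mset X \<subseteq> carrier R" "a \<in> carrier R"
    using P Q s ac good_imp_atom inert_imp_atom atoms_subset_carrier by auto
  have "mset_prod R (add_mset a P) \<sim> s \<otimes> a"
    using P(2) s(1) by (simp add: m_comm[of a] mult_cong_l associated_sym)
  moreover have "t \<otimes> mset_prod R X \<sim> mset_prod R (Q + X)"
    using Q(2) s(2) by (simp add: mult_cong_l)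
  ultimately have eq: "mset_prod R (add_mset a P) \<sim> mset_prod R (Q + X)"
    using s(4) associated_trans[of "mset_prod R (add_mset a P)" "s \<otimes> a"] by simp
  moreover have "set_mset (Q + X) \<subseteq> Collect (atom R)"
    using Q(1) s(3) good_imp_atom inert_imp_atom by auto
  ultimately have "size (P + {#a#}) = size (Q + X)"
    using atom_good_mset_balanced[OF a P(1), of "Q + X"] by simp
  moreover have "mset_prod R (P + {#a#}) \<sim> mset_prod R (Q + X)"
    using eq by simp
  ultimately show ?thesis
    using P(1) Q(1) s(3) by blast
qed

text \<open>The equalities for the single atoms are multiplied together; sizes add, so balance is
  preserved.\<close>

lemma atoms_balanced_split:
  assumes "set_mset M \<subseteq> Collect (atom R)"
  shows "\<exists>P Q X. set_mset P \<subseteq> Collect (good_atom R) \<and> set_mset Q \<subseteq> Collect (good_atom R) \<and>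
    set_mset X \<subseteq> Collect inert_atom \<and> mset_prod R (P + M) \<sim> mset_prod R (Q + X) \<and>
    size (P + M) = size (Q + X)"
  using assms
proof (induction M)
  case empty
  then show ?case
    by (intro exI[of _ "{#}"]) auto
next
  case (add a M)
  then have a: "atom R a" and M: "set_mset M \<subseteq> Collect (atom R)"
    by auto
  obtain P Q X where 1: "set_mset P \<subseteq> Collect (good_atom R)" "set_mset Q \<subseteq> Collect (good_atom R)"
    "set_mset X \<subseteq> Collect inert_atom" "mset_prod R (P + M) \<sim> mset_prod R (Q + X)"
    "size (P + M) = size (Q + X)"
    using add.IH[OF M] by blast
  obtain P' Q' X' where 2: "set_mset P' \<subseteq> Collect (good_atom R)" "set_mset Q' \<subseteq> Collect (good_atom R)"
    "set_mset X' \<subseteq> Collect inert_atom" "mset_prod R (P' + {#a#}) \<sim> mset_prod R (Q' + X')"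
    "size (P' + {#a#}) = size (Q' + X')"
    using atom_balanced_split[OF a] by blast
  have carr: "set_mset P \<subseteq> carrier R" "set_mset Q \<subseteq> carrier R" "set_mset X \<subseteq> carrier R"
    "set_mset P' \<subseteq> carrier R" "set_mset Q' \<subseteq> carrier R" "set_mset X' \<subseteq> carrier R"
    "set_mset M \<subseteq> carrier R" "a \<in> carrier R"
    using 1 2 M a atomD good_imp_atom inert_imp_atom atoms_subset_carrier by auto
  have "mset_prod R (P + M) \<otimes> mset_prod R (P' + {#a#}) \<sim> mset_prod R (Q + X) \<otimes> mset_prod R (Q' + X')"
    using 1(4) 2(4) by (rule mult_cong) (use carr in auto)
  then have "mset_prod R ((P + M) + (P' + {#a#})) \<sim> mset_prod R ((Q + X) + (Q' + X'))"
    by (subst (1 2) mset_prod_union) (use carr in auto)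
  \<comment> \<open>Good multipliers, given atoms and inert atoms are regrouped into the shape of
    the claim.\<close>
  then have "mset_prod R ((P + P') + add_mset a M) \<sim> mset_prod R ((Q + Q') + (X + X'))"
    by (simp only: ac_simps add_mset_add_single[of a M])
  then show ?case
    using 1 2 by (intro exI[of _ "P + P'"] exI[of _ "Q + Q'"] exI[of _ "X + X'"]) auto
qed

lemma is_half_factorial: "half_factorial_domain R"
proof (rule half_factorial_domainI)
  fix M N
  assume M: "set_mset M \<subseteq> Collect (atom R)" and N: "set_mset N \<subseteq> Collect (atom R)"
    and eq: "mset_prod R M = mset_prod R N"
  obtain P Q X where 1: "set_mset P \<subseteq> Collect (good_atom R)" "set_mset Q \<subseteq> Collect (good_atom R)"
    "set_mset X \<subseteq> Collect inert_atom" "mset_prod R (P + M) \<sim> mset_prod R (Q + X)"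
    "size (P + M) = size (Q + X)"
    using atoms_balanced_split[OF M] by blast
  obtain P' Q' X' where 2: "set_mset P' \<subseteq> Collect (good_atom R)" "set_mset Q' \<subseteq> Collect (good_atom R)"
    "set_mset X' \<subseteq> Collect inert_atom" "mset_prod R (P' + N) \<sim> mset_prod R (Q' + X')"
    "size (P' + N) = size (Q' + X')"
    using atoms_balanced_split[OF N] by blast
  have carr [simp]: "set_mset P \<subseteq> carrier R" "set_mset Q \<subseteq> carrier R" "set_mset X \<subseteq> carrier R"
    "set_mset P' \<subseteq> carrier R" "set_mset Q' \<subseteq> carrier R" "set_mset X' \<subseteq> carrier R"
    "set_mset M \<subseteq> carrier R" "set_mset N \<subseteq> carrier R"
    using 1 2 M N good_imp_atom inert_imp_atom atoms_subset_carrier by auto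
  \<comment> \<open>The two balanced equalities are linked through the common product of
    \<open>M\<close> and \<open>N\<close>: each is multiplied by the good multipliers of the other,
    \<open>P'\<close> or \<open>P\<close>, so that they share a middle term. The outer sides then
    contain only good or inert atoms.\<close>
  have "mset_prod R (P' + (Q + X)) \<sim> mset_prod R (P' + (P + M))"
    using 1(4) by (simp add: mult_cong_r associated_sym)
  also have "mset_prod R (P' + (P + M)) = mset_prod R (P + (P' + N))"
    using eq by (simp add: m_lcomm)
  also have "\<dots> \<sim> mset_prod R (P + (Q' + X'))"
    using 2(4) by (simp add: mult_cong_r)
  finally have "mset_prod R (P' + (Q + X)) \<sim> mset_prod R (P + (Q' + X'))"
    by simp
  moreover have "set_mset (P' + (Q + X)) \<subseteq> {x. good_atom R x \<or> inert_atom x}"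
    "set_mset (P + (Q' + X')) \<subseteq> {x. good_atom R x \<or> inert_atom x}"
    using 1 2 by auto
  ultimately have "size (P' + (Q + X)) = size (P + (Q' + X'))"
    using size_eq_if_good_or_inert by blast
  \<comment> \<open>By the two size equations, the sides just compared have sizes
    \<open>size P + size P' + size M\<close> and \<open>size P + size P' + size N\<close>.\<close>
  then show "size M = size N"
    using 1(5) 2(5) by simp
qed

end

theorem theorem9:
  fixes A :: "('a, 'b) ring_scheme" and S :: "'a set"
  assumes "atomic_domain A"
    and "saturated_mult_set A S"
    and "\<And>x. \<lbrakk>x \<in> S; x \<notin> Units A\<rbrakk> \<Longrightarrow>
      \<exists>n p. (\<forall>i\<in>{1..n::nat}. good_atom A (p i)) \<and> x = (\<Otimes>\<^bsub>A\<^esub>i\<in>{1..n}. p i)"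
    and "half_factorial_domain (localization A S)"
  shows "half_factorial_domain A"
proof -
  have "domain A"
    using assms(1) by (rule atomic_domain.axioms)
  then have "half_factorial_localization A S"
    using assms(2,4) by (intro half_factorial_localization.intro half_factorial_localization_axioms.intro)
  moreover have "atomic_half_factorial_localization_axioms A S"
    using assms(3) by (rule atomic_half_factorial_localization_axioms.intro)
  ultimately have "atomic_half_factorial_localization A S"
    using assms(1) by (intro atomic_half_factorial_localization.intro)
  then show ?thesis
    by (rule atomic_half_factorial_localization.is_half_factorial)
qed

end
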